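(* Let the basis functions $\phi_\ell$, $\ell\ge0$, be either the Bessel functions of the first kind $J_\ell$ or the modified Bessel functions of the first kind $I_\ell$, and let $W_N$ consist of the first $N$ coefficients of the expansion of $g$ in these functions. Then for all $t>0$ $$\|W_N\bar\varepsilon_N(t)\|\to 0\quad\text{as } N\to\infty .$$ Consequently, the truncation error satisfies $\|u(t)-u_N(t)\|\to0$ as $N\to\infty$ for every $t>0$.
   Context: $\|\cdot\|$ is the Euclidean vector norm or spectral matrix norm, and $e_1$ is the first unit vector of consistent size. $A\in\mathbb{C}^{n\times n}$, $u_0\in\mathbb{C}^n$, $g:\mathbb{C}\to\mathbb{C}^n$ has entire components, and $u$ is the solution of $u'(t)=Au(t)+g(t)$, $u(0)=u_0$. The function $g$ is expanded as $g(s)=\sum_{\ell=0}^\infty w_\ell\phi_\ell(s)$ with $w_\ell\in\mathbb{C}^n$, and $W_N=[w_0\ \cdots\ w_{N-1}]\in\mathbb{C}^{n\times N}$. Here $J_\ell(t)=\frac1\pi\int_0^\pi\cos(\ell\tau-t\sin\tau)\,d\tau$ and $I_\ell(t)=(-\mathrm i)^\ell J_\ell(\mathrm i t)$. For the Bessel functions, $H_N\in\mathbb{R}^{N\times N}$ is the tridiagonal matrix with zero diagonal, all subdiagonal entries equal to $\tfrac12$, first superdiagonal entry $(H_N)_{1,2}=-1$ and all other superdiagonal entries equal to $-\tfrac12$. For the modified Bessel functions, $H_N$ is the tridiagonal matrix with zero diagonal, all subdiagonal entries equal to $\tfrac12$, $(H_N)_{1,2}=1$ and all other superdiagonal entries equal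 to $\tfrac12$. $\bar\phi_N(t)=[\phi_0(t),\dots,\phi_{N-1}(t)]^{\mathrm T}$, $\bar\varepsilon_N(t)=\bar\phi_N(t)-\exp(tH_N)e_1$, and $$A_N=\begin{bmatrix}A&W_N\\0&H_N\end{bmatrix},\qquad u_N(t)=\begin{bmatrix}I_n&0\end{bmatrix}\exp(tA_N)\begin{bmatrix}u_0\\ e_1\end{bmatrix}.$$ *)

theory Defs
  imports "HOL-Analysis.Analysis" "Jordan_Normal_Form.Matrix"
begin

unbundle no vec_syntax
no_notation inner (infixl "\<bullet>" 70)

definition bessel_J :: "nat \<Rightarrow> complex \<Rightarrow> complex" where
  "bessel_J l z = 1 / of_real pi *
     integral {0..pi} (\<lambda>\<tau>. cos (of_nat l * of_real \<tau> - z * of_real (sin \<tau>)))"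

definition bessel_I :: "nat \<Rightarrow> complex \<Rightarrow> complex" where
  "bessel_I l z = (- \<i>) ^ l * bessel_J l (\<i> * z)"

text \<open>Rows and columns are counted from 0. The matrices are real, but their entries are
  regarded as complex numbers so that they can be blocks of complex matrices.\<close>

definition H_J :: "nat \<Rightarrow> complex Matrix.mat" where
  "H_J N = Matrix.mat N N (\<lambda>(i, j).
     if i = Suc j then 1 / 2
     else if j = Suc i then (if i = 0 then - 1 else - (1 / 2))
     else 0)"

definition H_I :: "nat \<Rightarrow> complex Matrix.mat" where
  "H_I N = Matrix.mat N N (\<lambda>(i, j).
     if i = Suc j then 1 / 2
     else if j = Suc i then (if i = 0 then 1 else 1 / 2)
     else 0)"

definition vec_norm :: "complex Matrix.vec \<Rightarrow> real" where
  "vec_norm v = sqrt (\<Sum>i<dim_vec v. (cmod (v $ i))\<^sup>2)"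

text \<open>The power series of the exponential, summed entrywise; it is meant for square matrices,
  where the series of each entry converges absolutely.\<close>

definition mat_exp :: "complex Matrix.mat \<Rightarrow> complex Matrix.mat" where
  "mat_exp A = Matrix.mat (dim_row A) (dim_col A)
     (\<lambda>(i, j). \<Sum>k. (A ^\<^sub>m k) $$ (i, j) / fact k)"

definition coeff_mat :: "nat \<Rightarrow> (nat \<Rightarrow> complex Matrix.vec) \<Rightarrow> nat \<Rightarrow> complex Matrix.mat" where
  "coeff_mat n w N = mat_of_cols n (map w [0..<N])"

definition basis_err ::
  "(nat \<Rightarrow> complex \<Rightarrow> complex) \<Rightarrow> (nat \<Rightarrow> complex Matrix.mat) \<Rightarrow> nat \<Rightarrow> real \<Rightarrow> complex Matrix.vec" where
  "basis_err \<phi> H N t =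
     Matrix.vec N (\<lambda>l. \<phi> l (of_real t)) - mat_exp (of_real t \<cdot>\<^sub>m H N) *\<^sub>v unit_vec N 0"

definition aug_mat ::
  "nat \<Rightarrow> complex Matrix.mat \<Rightarrow> (nat \<Rightarrow> complex Matrix.vec) \<Rightarrow> (nat \<Rightarrow> complex Matrix.mat) \<Rightarrow>
   nat \<Rightarrow> complex Matrix.mat" where
  "aug_mat n A w H N = four_block_mat A (coeff_mat n w N) (0\<^sub>m N n) (H N)"

text \<open>The first factor is the \<open>n\<close> by \<open>n + N\<close> matrix \<open>[I 0]\<close>, written as a block matrix whose
  lower blocks have no rows.\<close>

definition approx_sol ::
  "nat \<Rightarrow> complex Matrix.mat \<Rightarrow> complex Matrix.vec \<Rightarrow> (nat \<Rightarrow> complex Matrix.vec) \<Rightarrow>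
   (nat \<Rightarrow> complex Matrix.mat) \<Rightarrow> nat \<Rightarrow> real \<Rightarrow> complex Matrix.vec" where
  "approx_sol n A u0 w H N t =
     four_block_mat (1\<^sub>m n) (0\<^sub>m n N) (0\<^sub>m 0 n) (0\<^sub>m 0 N) *\<^sub>v
       (mat_exp (of_real t \<cdot>\<^sub>m aug_mat n A w H N) *\<^sub>v (u0 @\<^sub>v unit_vec N 0))"

end

theory Submission
  imports Defs
begin

text \<open>
  Put \<open>\<sigma> = - 1\<close> for the functions \<open>J\<^sub>l\<close> and \<open>\<sigma> = 1\<close> for the functions \<open>I\<^sub>l\<close>. Either family solves the
  infinite linear system \<open>\<phi>' = H \<phi>\<close>, \<open>\<phi>(0) = e\<^sub>1\<close>, whose matrix \<open>H\<close> has \<open>H\<^sub>N\<close> as its leading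
  \<open>N \<times> N\<close> block. So \<open>\<phi>\<^sub>l\<close> has the Taylor coefficients \<open>(H\<^sup>k e\<^sub>1)\<^sub>l / k!\<close>, with \<open>(H\<^sup>k e\<^sub>1)\<^sub>l\<close> given by the
  recursion \<open>bessel_coeff\<close>; the numbers \<open>(H\<^sup>k e\<^sub>1)\<^sub>l\<close> are at most 1 in modulus. Since \<open>H\<close> is tridiagonal,
  cutting it off at size \<open>N\<close> is not noticed by \<open>H\<^sup>k e\<^sub>1\<close> as long as \<open>k < N\<close>. Hence the
  Taylor series of every entry of \<open>\<epsilon>\<^sub>N(s)\<close> has no power below \<open>s\<^sup>N\<close>, and its terms are at most
  \<open>2 s\<^sup>k / k!\<close>, so that the entry is at most \<open>2 e\<^sup>s s\<^sup>N / N!\<close> in modulus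
  (\<open>norm_basis_err_le\<close>).

  This has to beat the growth of the \<open>w\<^sub>l\<close>, which may be nearly factorial. At a point \<open>z\<close> of the positive
  real axis (for \<open>I\<^sub>l\<close>) or the positive imaginary axis (for \<open>J\<^sub>l\<close>) all terms of the Taylor series of \<open>\<phi>\<^sub>l\<close>
  have the same argument, so \<open>\<bar>\<phi>\<^sub>l(z)\<bar>\<close> is at least its leading term \<open>\<bar>z/2\<bar>\<^sup>l / l!\<close>. The terms of
  the convergent series \<open>\<Sum>w\<^sub>l \<phi>\<^sub>l(z)\<close> are bounded, and therefore \<open>\<bar>w\<^sub>l\<bar> \<le> C l! / R\<^sup>l\<close> for any
  prescribed \<open>R > 0\<close>   (\<open>expansion_coeff_decay\<close>). As \<open>l! (N - l)! \<le> N!\<close>, it follows that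
  \<open>\<Sum>\<^bsub>l<N\<^esub> \<bar>w\<^sub>l\<bar> / N! \<le> C e\<^sup>R / R\<^sup>N\<close>, and with \<open>R = 2 t\<close> both \<open>W\<^sub>N \<epsilon>\<^sub>N(s)\<close> and the tail of the expansion of
  \<open>g(s)\<close> are \<open>O(2\<^bsup>-N\<^esup>)\<close>, uniformly for \<open>0 \<le> s \<le> t\<close> (\<open>expansion_errors_le\<close>).

  The difference \<open>u - u\<^sub>N\<close> vanishes at 0 and solves \<open>d' = A d + r\<close> where the residual
  \<open>r(s) = g(s) - W\<^sub>N exp(s H\<^sub>N) e\<^sub>1\<close> is the sum of those two errors. An energy estimate
  (\<open>linear_system_perturbation_bound\<close>) bounds \<open>d(t)\<close> by a multiple of the supremum of \<open>r\<close>, with a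
  factor that depends on \<open>A\<close> and \<open>t\<close> only.
\<close>

section \<open>Taylor coefficients of the Bessel functions\<close>

text \<open>
  The entry \<open>(H\<^sup>k e\<^sub>1)\<^sub>l\<close> of the infinite tridiagonal matrix \<open>H\<close>, equivalently the \<open>k\<close>-th derivative
  at 0 of the \<open>l\<close>-th basis function; the equations are the recurrences \<open>\<phi>\<^sub>0' = \<sigma> \<phi>\<^sub>1\<close> and
  \<open>\<phi>\<^bsub>l+1\<^esub>' = (\<phi>\<^sub>l + \<sigma> \<phi>\<^bsub>l+2\<^esub>) / 2\<close>.
\<close>

fun bessel_coeff :: "complex \<Rightarrow> nat \<Rightarrow> nat \<Rightarrow> complex" where
  "bessel_coeff \<sigma> 0 l = (if l = 0 then 1 else 0)"
| "bessel_coeff \<sigma> (Suc k) 0 = \<sigma> * bessel_coeff \<sigma> k 1"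
| "bessel_coeff \<sigma> (Suc k) (Suc l) =
     (bessel_coeff \<sigma> k l + \<sigma> * bessel_coeff \<sigma> k (Suc (Suc l))) / 2"

lemma norm_bessel_coeff_le_1:
  assumes "cmod \<sigma> \<le> 1"
  shows "cmod (bessel_coeff \<sigma> k l) \<le> 1"
  using assms
proof (induction \<sigma> k l rule: bessel_coeff.induct)
  case (3 \<sigma> k l)
  have "cmod (\<sigma> * bessel_coeff \<sigma> k (Suc (Suc l))) \<le> 1"
    unfolding norm_mult using 3 by (intro mult_le_one) auto
  then have "cmod (bessel_coeff \<sigma> k l + \<sigma> * bessel_coeff \<sigma> k (Suc (Suc l))) \<le> 1 + 1"
    using 3 by (intro norm_triangle_mono) auto
  then show ?case by (simp add: norm_divide)
qed (auto simp: norm_mult intro: mult_le_one)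

lemma bessel_coeff_eq_0: "k < l \<Longrightarrow> bessel_coeff \<sigma> k l = 0"
  by (induction \<sigma> k l rule: bessel_coeff.induct) auto

lemma bessel_coeff_diag: "bessel_coeff \<sigma> l l = 1 / 2 ^ l"
  by (induction l) (auto simp: bessel_coeff_eq_0)

lemma bessel_coeff_1_nonneg: "\<exists>r\<ge>0. bessel_coeff 1 k l = of_real r"
proof (induction "1::complex" k l rule: bessel_coeff.induct)
  case (1 l)
  show ?case by (auto intro: exI[of _ 1] exI[of _ 0])
next
  case (2 k)
  then show ?case by simp
next
  case (3 k l)
  then obtain r r' where "r \<ge> 0" "r' \<ge> 0" "bessel_coeff 1 k l = of_real r"
    "bessel_coeff 1 k (Suc (Suc l)) = of_real r'" by auto
  then show ?case by (intro exI[of _ "(r + r') / 2"]) auto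
qed

text \<open>
  The coefficient form of \<open>I\<^sub>l(z) = (-\<i>)\<^sup>l J\<^sub>l(\<i> z)\<close>; it transfers the power series of \<open>J\<^sub>l\<close> to \<open>I\<^sub>l\<close>.
\<close>

lemma bessel_coeff_rotate:
  "\<i> ^ k * (- \<i>) ^ l * bessel_coeff (-1) k l = bessel_coeff 1 k l"
proof (induction "1::complex" k l rule: bessel_coeff.induct)
  case (2 k)
  show ?case using 2[symmetric] by simp
next
  case (3 k l)
  have "\<i> ^ Suc k * (- \<i>) ^ Suc l * bessel_coeff (-1) (Suc k) (Suc l) =
    (\<i> ^ k * (- \<i>) ^ l * bessel_coeff (-1) k l +
     \<i> ^ k * (- \<i>) ^ Suc (Suc l) * bessel_coeff (-1) k (Suc (Suc l))) / 2"
    by (simp add: field_simps)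
  then show ?case unfolding 3 by simp
qed auto

section \<open>Power series of the Bessel functions\<close>

text \<open>
  The \<open>k\<close>-th derivative at \<open>z = 0\<close> of the integrand \<open>cos (l \<tau> - z sin \<tau>)\<close> of \<open>J\<^sub>l(z)\<close>. The cosine is
  split into exponentials because differentiation then just multiplies by \<open>\<mp>\<i> sin \<tau>\<close>, and \<open>l\<close> is an
  integer because the recurrence for \<open>l = 0\<close> passes through \<open>l = - 1\<close>.
\<close>

definition fourier_term :: "int \<Rightarrow> nat \<Rightarrow> real \<Rightarrow> complex" where
  "fourier_term l k \<tau> = (cis (of_int l * \<tau>) * (- \<i> * of_real (sin \<tau>)) ^ k +
                   cis (- (of_int l * \<tau>)) * (\<i> * of_real (sin \<tau>)) ^ k) / 2"

definition fourier_moment :: "int \<Rightarrow> nat \<Rightarrow> complex" where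
  "fourier_moment l k = integral {0..pi} (fourier_term l k)"

lemma continuous_on_fourier_term: "continuous_on S (fourier_term l k)"
  unfolding fourier_term_def by (intro continuous_intros) simp

lemma fourier_term_integrable: "fourier_term l k integrable_on {0..pi}"
  by (intro integrable_continuous_real continuous_on_fourier_term)

lemma fourier_moment_0: "fourier_moment (int l) 0 = (if l = 0 then of_real pi else 0)"
proof -
  have eq: "fourier_term (int l) 0 = (\<lambda>\<tau>. of_real (cos (real l * \<tau>)))"
    by (auto simp: fourier_term_def fun_eq_iff complex_eq_iff)
  have "((\<lambda>\<tau>. cos (real l * \<tau>)) has_integral (if l = 0 then pi else 0)) {0..pi}"
  proof (cases "l = 0")
    case True
    then show ?thesis using has_integral_const_real[of "1::real" 0 pi] by simp
  next
    case False
    have "((\<lambda>\<tau>. cos (real l * \<tau>)) has_integral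
        (sin (real l * pi) / real l - sin (real l * 0) / real l)) {0..pi}"
      using False
      by (intro fundamental_theorem_of_calculus)
        (auto simp flip: has_real_derivative_iff_has_vector_derivative intro!: derivative_eq_intros)
    then show ?thesis using False by (simp add: mult.commute)
  qed
  from has_integral_linear[OF this bounded_linear_of_real[where 'a = complex]]
  show ?thesis unfolding fourier_moment_def eq by (auto simp: o_def integral_unique)
qed

text \<open>
  The extra factor \<open>\<mp>\<i> sin \<tau>\<close> is half a difference of exponentials, which shift the frequency \<open>l\<close>
  by one in either direction.
\<close>

lemma fourier_moment_Suc:
  "fourier_moment l (Suc k) = (fourier_moment (l - 1) k - fourier_moment (l + 1) k) / 2"
proof -
  have "fourier_term l (Suc k) \<tau> = (fourier_term (l - 1) k \<tau> - fourier_term (l + 1) k \<tau>) / 2" for \<tau>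
  proof -
    have s: "- \<i> * of_real (sin \<tau>) = (cis (-\<tau>) - cis \<tau>) / 2" "\<i> * of_real (sin \<tau>) = (cis \<tau> - cis (-\<tau>)) / 2"
      by (auto simp: complex_eq_iff)
    have c: "cis (of_int (l - 1) * \<tau>) = cis (of_int l * \<tau>) * cis (-\<tau>)"
      "cis (of_int (l + 1) * \<tau>) = cis (of_int l * \<tau>) * cis \<tau>"
      "cis (- (of_int (l - 1) * \<tau>)) = cis (- (of_int l * \<tau>)) * cis \<tau>"
      "cis (- (of_int (l + 1) * \<tau>)) = cis (- (of_int l * \<tau>)) * cis (-\<tau>)"
      by (auto simp: cis_mult algebra_simps)
    show ?thesis unfolding fourier_term_def c power_Suc s by (simp add: field_simps)
  qed
  then have "fourier_term l (Suc k) =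
      (\<lambda>\<tau>. (1 / 2) * (fourier_term (l - 1) k \<tau> - fourier_term (l + 1) k \<tau>))"
    by (simp add: fun_eq_iff)
  then show ?thesis unfolding fourier_moment_def
    by (simp add: integral_diff fourier_term_integrable)
qed

text \<open>
  The substitution \<open>\<tau> \<mapsto> \<pi> - \<tau>\<close> fixes \<open>sin \<tau>\<close> and maps \<open>cis (-\<tau>)\<close> to \<open>- cis \<tau>\<close>; this is
  \<open>J\<^bsub>-1\<^esub> = - J\<^sub>1\<close>, and it accounts for the exceptional first row of the matrices \<open>H\<^sub>N\<close>.
\<close>

lemma fourier_moment_minus_1: "fourier_moment (-1) k = - fourier_moment 1 k"
proof -
  have "(fourier_term (-1) k has_integral fourier_moment (-1) k) {0..pi}"
    unfolding fourier_moment_def using fourier_term_integrable by (simp add: has_integral_integral)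
  from has_integral_affinity[of _ _ "0::real" pi "-1" pi, simplified, OF this]
  have "((\<lambda>\<tau>. fourier_term (-1) k (pi - \<tau>)) has_integral fourier_moment (-1) k) {0..pi}"
    by (simp)
  moreover have "fourier_term (-1) k (pi - \<tau>) = - fourier_term 1 k \<tau>" for \<tau>
  proof -
    have "cis (pi - \<tau>) = - cis (-\<tau>)" "cis (\<tau> - pi) = - cis \<tau>"
      by (auto simp: complex_eq_iff sin_diff cos_diff)
    then show ?thesis by (simp add: fourier_term_def field_simps)
  qed
  ultimately have "((\<lambda>\<tau>. - fourier_term 1 k \<tau>) has_integral fourier_moment (-1) k) {0..pi}"
    by simp
  then show ?thesis
    unfolding fourier_moment_def by (metis integral_neg integral_unique)
qed

lemma fourier_moment_eq_bessel_coeff: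
  "fourier_moment (int l) k = of_real pi * bessel_coeff (-1) k l"
proof (induction "- 1::complex" k l rule: bessel_coeff.induct)
  case (1 l)
  then show ?case by (simp add: fourier_moment_0)
next
  case (2 k)
  then show ?case by (simp add: fourier_moment_Suc fourier_moment_minus_1)
next
  case (3 k l)
  have "int (Suc l) - 1 = int l" "int (Suc l) + 1 = int (Suc (Suc l))" by auto
  then show ?case unfolding fourier_moment_Suc using 3 by (simp add: algebra_simps)
qed

lemma cos_sums_fourier_term:
  "(\<lambda>k. z ^ k / fact k * fourier_term (int l) k \<tau>) sums
     cos (of_nat l * of_real \<tau> - z * of_real (sin \<tau>))"
proof -
  let ?a = "cis (real l * \<tau>)" and ?b = "cis (- (real l * \<tau>))"
  let ?x = "z * (- \<i> * of_real (sin \<tau>))" and ?y = "z * (\<i> * of_real (sin \<tau>))"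
  have "(\<lambda>k. (?a * (?x ^ k /\<^sub>R fact k) + ?b * (?y ^ k /\<^sub>R fact k)) / 2) sums
      ((?a * exp ?x + ?b * exp ?y) / 2)"
    by (intro sums_divide sums_add sums_mult exp_converges)
  moreover have "(?a * (?x ^ k /\<^sub>R fact k) + ?b * (?y ^ k /\<^sub>R fact k)) / 2 =
      z ^ k / fact k * fourier_term (int l) k \<tau>" for k
    unfolding fourier_term_def power_mult_distrib
    by (simp add: scaleR_conv_of_real field_simps)
  moreover have "(?a * exp ?x + ?b * exp ?y) / 2 =
      cos (of_nat l * of_real \<tau> - z * of_real (sin \<tau>))"
    unfolding cos_exp_eq cis_conv_exp exp_add[symmetric] by (simp add: algebra_simps)
  ultimately show ?thesis by simp
qed

lemma norm_fourier_term_le_1: "cmod (fourier_term l k \<tau>) \<le> 1"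
proof -
  have "cmod ((- \<i> * of_real (sin \<tau>)) ^ k) \<le> 1" "cmod ((\<i> * of_real (sin \<tau>)) ^ k) \<le> 1"
    by (auto simp: norm_power norm_mult power_le_one)
  then have "cmod (cis (of_int l * \<tau>) * (- \<i> * of_real (sin \<tau>)) ^ k +
                   cis (- (of_int l * \<tau>)) * (\<i> * of_real (sin \<tau>)) ^ k) \<le> 1 + 1"
    by (intro norm_triangle_mono) (simp_all add: norm_mult)
  then show ?thesis unfolding fourier_term_def by (simp add: norm_divide)
qed

text \<open>
  The series of the integrand converges uniformly in \<open>\<tau>\<close> (its terms are dominated by
  \<open>\<bar>z\<bar>\<^sup>k / k!\<close>), so it may be integrated term by term.
\<close>

lemma bessel_J_sums: "(\<lambda>k. bessel_coeff (-1) k l * z ^ k / fact k) sums bessel_J l z"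
proof -
  define c where "c \<tau> = cos (of_nat l * of_real \<tau> - z * of_real (sin \<tau>))" for \<tau> :: real
  define f where "f k \<tau> = z ^ k / fact k * fourier_term (int l) k \<tau>" for k \<tau>
  have "uniform_limit {0..pi} (\<lambda>K \<tau>. \<Sum>k<K. f k \<tau>) (\<lambda>\<tau>. \<Sum>k. f k \<tau>) sequentially"
  proof (rule Weierstrass_m_test)
    show "summable (\<lambda>k. cmod z ^ k / fact k)"
      using summable_exp[of "cmod z"] by (simp add: field_simps)
    show "cmod (f k \<tau>) \<le> cmod z ^ k / fact k" for k \<tau>
      unfolding f_def norm_mult norm_divide norm_power norm_fact
      using norm_fourier_term_le_1[of "int l" k \<tau>] by (intro mult_left_le) auto
  qed
  moreover have "(\<Sum>k. f k \<tau>) = c \<tau>" for \<tau>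
    using cos_sums_fourier_term unfolding f_def c_def by (rule sums_unique[symmetric])
  ultimately have "uniform_limit {0..pi} (\<lambda>K \<tau>. \<Sum>k<K. f k \<tau>) c sequentially" by simp
  then obtain I C where I: "\<And>K. ((\<lambda>\<tau>. \<Sum>k<K. f k \<tau>) has_integral I K) {0..pi}"
    and C: "(c has_integral C) {0..pi}" and lim: "I \<longlonglongrightarrow> C"
    by (rule uniform_limit_integral)
      (auto simp: f_def intro!: continuous_intros continuous_on_fourier_term)
  have "I K = (\<Sum>k<K. of_real pi * (bessel_coeff (-1) k l * z ^ k / fact k))" for K
  proof -
    have "(f k has_integral z ^ k / fact k * fourier_moment (int l) k) {0..pi}" for k
      unfolding f_def fourier_moment_def
      by (intro has_integral_mult_right integrable_integral fourier_term_integrable)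
    then have "((\<lambda>\<tau>. \<Sum>k<K. f k \<tau>) has_integral
        (\<Sum>k<K. z ^ k / fact k * fourier_moment (int l) k)) {0..pi}"
      by (intro has_integral_sum) auto
    with I have "I K = (\<Sum>k<K. z ^ k / fact k * fourier_moment (int l) k)"
      by (rule has_integral_unique)
    then show ?thesis by (simp add: fourier_moment_eq_bessel_coeff mult_ac)
  qed
  then have "I = (\<lambda>K. \<Sum>k<K. of_real pi * (bessel_coeff (-1) k l * z ^ k / fact k))"
    by (rule ext)
  with lim have "(\<lambda>k. of_real pi * (bessel_coeff (-1) k l * z ^ k / fact k)) sums C"
    unfolding sums_def by simp
  from sums_mult[OF this, of "1 / of_real pi"]
  have "(\<lambda>k. bessel_coeff (-1) k l * z ^ k / fact k) sums (1 / of_real pi * C)"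
    by simp
  also have "1 / of_real pi * C = bessel_J l z"
    using C unfolding bessel_J_def c_def by (simp add: integral_unique)
  finally show ?thesis .
qed

lemma bessel_I_sums: "(\<lambda>k. bessel_coeff 1 k l * z ^ k / fact k) sums bessel_I l z"
proof -
  have "(- \<i>) ^ l * (bessel_coeff (-1) k l * (\<i> * z) ^ k / fact k) =
      bessel_coeff 1 k l * z ^ k / fact k" for k
    by (simp add: power_mult_distrib mult_ac flip: bessel_coeff_rotate)
  then show ?thesis
    using sums_mult[OF bessel_J_sums[of l "\<i> * z"], of "(- \<i>) ^ l"] by (simp add: bessel_I_def)
qed

text \<open>
  At \<open>x \<ge> 0\<close> all terms of the power series are nonnegative, so the sum is at least the term with
  \<open>k = l\<close>, which is the leading one.
\<close>

lemma norm_bessel_I_ge: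
  assumes "x \<ge> 0"
  shows "(x / 2) ^ l / fact l \<le> cmod (bessel_I l (of_real x))"
proof -
  define t where "t k = Re (bessel_coeff 1 k l * of_real x ^ k / fact k)" for k
  have nonneg: "t k \<ge> 0" for k
  proof -
    obtain r where "r \<ge> 0" "bessel_coeff 1 k l = of_real r" using bessel_coeff_1_nonneg by auto
    then have "bessel_coeff 1 k l * of_real x ^ k / fact k = of_real (r * x ^ k / fact k)"
      by simp
    then show ?thesis unfolding t_def using \<open>r \<ge> 0\<close> assms by (simp only: Re_complex_of_real) simp
  qed
  have s: "t sums Re (bessel_I l (of_real x))"
    unfolding t_def by (intro sums_Re bessel_I_sums)
  have "bessel_coeff 1 l l * of_real x ^ l / fact l = of_real ((x / 2) ^ l / fact l)"
    by (simp add: bessel_coeff_diag power_divide)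
  then have "(x / 2) ^ l / fact l = t l"
    unfolding t_def by (simp only: Re_complex_of_real)
  also have "\<dots> = sum t {l}" by simp
  also have "\<dots> \<le> Re (bessel_I l (of_real x))"
    unfolding sums_unique[OF s] using s nonneg by (intro sum_le_suminf) (auto simp: sums_iff)
  also have "\<dots> \<le> cmod (bessel_I l (of_real x))" by (rule complex_Re_le_cmod)
  finally show ?thesis .
qed

section \<open>Estimates for series\<close>

text \<open>
  Because \<open>(k + N)! \<ge> k! N!\<close>, an exponential series without its first \<open>N\<close> terms is at most the
  full series times \<open>s\<^sup>N / N!\<close>.
\<close>

lemma norm_exp_series_tail_le:
  fixes c :: "nat \<Rightarrow> complex"
  assumes zero: "\<And>k. k < N \<Longrightarrow> c k = 0" and bound: "\<And>k. cmod (c k) \<le> B"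
    and "s \<ge> 0" and S: "(\<lambda>k. c k * of_real s ^ k / fact k) sums S"
  shows "cmod S \<le> B * exp s * s ^ N / fact N"
proof -
  have "B \<ge> 0" using bound[of 0] norm_ge_zero order_trans by blast
  let ?f = "\<lambda>k. c (k + N) * of_real s ^ (k + N) / fact (k + N)"
  let ?g = "\<lambda>k. B * s ^ N / fact N * (s ^ k /\<^sub>R fact k)"
  have f: "?f sums S"
    using S by (subst sums_zero_iff_shift) (auto simp: zero)
  have g: "?g sums (B * s ^ N / fact N * exp s)"
    by (intro sums_mult exp_converges)
  have "cmod (?f k) \<le> ?g k" for k
  proof -
    have "(fact k * fact N :: nat) \<le> fact (k + N)"
      by (intro dvd_imp_le fact_fact_dvd_fact) simp
    then have "(fact k * fact N :: real) \<le> fact (k + N)"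
      by (metis of_nat_fact of_nat_le_iff of_nat_mult)
    then have "cmod (c (k + N)) * s ^ (k + N) / fact (k + N) \<le> B * s ^ (k + N) / (fact k * fact N)"
      using bound \<open>B \<ge> 0\<close> \<open>s \<ge> 0\<close> by (intro frac_le mult_right_mono) auto
    then show ?thesis
      using \<open>s \<ge> 0\<close> by (simp add: norm_mult norm_divide norm_power power_add field_simps)
  qed
  then have "cmod (suminf ?f) \<le> suminf ?g"
    using g by (intro norm_suminf_le) (auto simp: sums_iff)
  then have "cmod S \<le> B * s ^ N / fact N * exp s"
    unfolding sums_unique[OF f, symmetric] sums_unique[OF g, symmetric] .
  then show ?thesis by (simp add: mult_ac)
qed

text \<open>
  By \<open>l! (N - l)! \<le> N!\<close> the \<open>l\<close>-th summand is at most \<open>C B R\<^bsup>-N\<^esup>\<close> times \<open>R\<^bsup>N-l\<^esup> / (N - l)!\<close>, and the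
  latter are terms of the exponential series of \<open>R\<close>. So coefficients that grow like \<open>l! / R\<^sup>l\<close> still
  leave the geometric factor \<open>R\<^bsup>-N\<^esup>\<close>.
\<close>

lemma norm_sum_fact_weights_le:
  fixes c e :: "nat \<Rightarrow> complex"
  assumes c: "\<And>l. cmod (c l) \<le> C * fact l / R ^ l" and "R > 0"
    and e: "\<And>l. l < N \<Longrightarrow> cmod (e l) \<le> B / fact N"
    and "B \<ge> 0" "C \<ge> 0"
  shows "cmod (\<Sum>l<N. c l * e l) \<le> C * B * exp R / R ^ N"
proof -
  let ?r = "\<lambda>j. R ^ j /\<^sub>R fact j"
  have "cmod (c l * e l) \<le> C * B / R ^ N * ?r (N - l)" if "l < N" for l
  proof -
    have "(fact l * fact (N - l) :: nat) \<le> fact N"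
      using fact_fact_dvd_fact[of l "N - l", where 'a = nat] that by (intro dvd_imp_le) auto
    then have f: "(fact l * fact (N - l) :: real) \<le> fact N"
      by (metis of_nat_fact of_nat_le_iff of_nat_mult)
    have "cmod (c l * e l) \<le> (C * fact l / R ^ l) * (B / fact N)"
      unfolding norm_mult using c e[OF that] assms by (intro mult_mono) auto
    also have "\<dots> = C * B / R ^ l * (fact l / fact N)" by simp
    also have "\<dots> \<le> C * B / R ^ l * (1 / fact (N - l))"
      using f assms by (intro mult_left_mono) (auto simp: field_simps)
    also have "\<dots> = C * B / R ^ N * ?r (N - l)"
    proof -
      have "R ^ N = R ^ l * R ^ (N - l)" using that by (simp flip: power_add)
      then show ?thesis using \<open>R > 0\<close> by (simp add: field_simps)
    qed
    finally show ?thesis .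
  qed
  then have "cmod (\<Sum>l<N. c l * e l) \<le> (\<Sum>l<N. C * B / R ^ N * ?r (N - l))"
    by (intro sum_norm_le) auto
  also have "\<dots> = C * B / R ^ N * (\<Sum>l<N. ?r (N - l))" by (simp add: sum_distrib_left)
  also have "(\<Sum>l<N. ?r (N - l)) = sum ?r ((\<lambda>l. N - l) ` {..<N})"
    by (subst sum.reindex) (auto simp: inj_on_def)
  also have "\<dots> \<le> exp R"
    using exp_converges[of R] \<open>R > 0\<close> unfolding sums_iff
    by (metis (no_types, lifting) finite_imageI finite_lessThan less_imp_le sum_le_suminf
        scaleR_nonneg_nonneg inverse_nonnegative_iff_nonnegative fact_ge_zero zero_le_power)
  finally show ?thesis using assms by (simp add: mult_left_mono divide_right_mono)
qed

lemma norm_geometric_tail_le: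
  fixes f :: "nat \<Rightarrow> complex"
  assumes S: "f sums S" and f: "\<And>l. cmod (f l) \<le> C / 2 ^ l"
  shows "cmod (S - sum f {..<N}) \<le> 2 * C / 2 ^ N"
proof -
  have S': "(\<lambda>l. f (l + N)) sums (S - sum f {..<N})"
    by (rule sums_split_initial_segment[OF S])
  have g: "(\<lambda>l. C / 2 ^ N * (1 / 2) ^ l) sums (C / 2 ^ N * 2)"
    using geometric_sums[of "1 / 2 :: real"] by (intro sums_mult) simp
  have "cmod (f (l + N)) \<le> C / 2 ^ N * (1 / 2) ^ l" for l
    using f[of "l + N"] by (simp add: power_add power_divide mult.commute)
  then have "cmod (\<Sum>l. f (l + N)) \<le> (\<Sum>l. C / 2 ^ N * (1 / 2) ^ l)"
    using g by (intro norm_suminf_le) (auto simp: sums_iff)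
  then show ?thesis using S' g by (simp add: sums_iff mult.commute)
qed

section \<open>Powers and exponentials of matrices acting on vectors\<close>

lemma mult_mat_vec_index_sum:
  assumes "M \<in> carrier_mat m m'" "v \<in> carrier_vec m'" "i < m"
  shows "(M *\<^sub>v v) $ i = (\<Sum>j<m'. M $$ (i, j) * v $ j)"
  using assms by (auto simp: scalar_prod_def atLeast0LessThan intro!: sum.cong)

lemma pow_mat_Suc_left:
  assumes "(M :: complex Matrix.mat) \<in> carrier_mat m m"
  shows "M ^\<^sub>m Suc k = M * M ^\<^sub>m k"
proof (induction k)
  case 0
  then show ?case using assms by simp
next
  case (Suc k)
  have "M ^\<^sub>m Suc (Suc k) = M * M ^\<^sub>m k * M" using Suc by simp
  also have "\<dots> = M * (M ^\<^sub>m k * M)"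
    using assms by (intro assoc_mult_mat[of _ m m _ m _ m]) auto
  finally show ?case by simp
qed

lemma pow_mat_Suc_mult_vec:
  assumes "(M :: complex Matrix.mat) \<in> carrier_mat m m" "v \<in> carrier_vec m"
  shows "M ^\<^sub>m Suc k *\<^sub>v v = M *\<^sub>v (M ^\<^sub>m k *\<^sub>v v)"
  unfolding pow_mat_Suc_left[OF assms(1)]
  using assms by (intro assoc_mult_mat_vec[of _ m m _ m]) auto

text \<open>
  The sum of all entries in modulus dominates every absolute column sum, which makes the bound pass
  through each multiplication by \<open>M\<close>; it gives the absolute convergence of the exponential series.
\<close>

lemma norm_pow_mat_entry_le:
  assumes M: "M \<in> carrier_mat m m" and "i < m" "j < m"
  shows "cmod ((M ^\<^sub>m k) $$ (i, j)) \<le> (\<Sum>p<m. \<Sum>q<m. cmod (M $$ (p, q))) ^ k"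
  using \<open>j < m\<close>
proof (induction k arbitrary: j)
  case 0
  then show ?case using assms by simp
next
  case (Suc k)
  let ?B = "\<Sum>p<m. \<Sum>q<m. cmod (M $$ (p, q))"
  have col: "(\<Sum>p<m. cmod (M $$ (p, j))) \<le> ?B"
    using Suc.prems by (intro sum_mono member_le_sum) auto
  have Mk: "M ^\<^sub>m k \<in> carrier_mat m m" using M by simp
  have "(M ^\<^sub>m Suc k) $$ (i, j) = (\<Sum>p<m. (M ^\<^sub>m k) $$ (i, p) * M $$ (p, j))"
    using M Mk assms Suc.prems by (auto simp: scalar_prod_def atLeast0LessThan intro!: sum.cong)
  also have "cmod \<dots> \<le> (\<Sum>p<m. ?B ^ k * cmod (M $$ (p, j)))"
    using Suc.IH by (intro sum_norm_le) (auto simp: norm_mult intro!: mult_right_mono)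
  also have "\<dots> \<le> ?B ^ k * ?B"
    unfolding sum_distrib_left[symmetric] using col by (intro mult_left_mono) (auto intro!: sum_nonneg zero_le_power)
  finally show ?case by (simp add: mult.commute)
qed

lemma pow_smult_mat_index:
  assumes M: "(M :: complex Matrix.mat) \<in> carrier_mat m m" and "i < m" "j < m"
  shows "((z \<cdot>\<^sub>m M) ^\<^sub>m k) $$ (i, j) = z ^ k * (M ^\<^sub>m k) $$ (i, j)"
  using \<open>j < m\<close>
proof (induction k arbitrary: j)
  case 0
  then show ?case using assms by simp
next
  case (Suc k)
  have Mk: "M ^\<^sub>m k \<in> carrier_mat m m" "(z \<cdot>\<^sub>m M) ^\<^sub>m k \<in> carrier_mat m m" using M by simp_all
  have "((z \<cdot>\<^sub>m M) ^\<^sub>m Suc k) $$ (i, j) = (\<Sum>p<m. ((z \<cdot>\<^sub>m M) ^\<^sub>m k) $$ (i, p) * (z * M $$ (p, j)))"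
    using M Mk assms Suc.prems by (auto simp: scalar_prod_def atLeast0LessThan intro!: sum.cong)
  also have "\<dots> = z ^ Suc k * (\<Sum>p<m. (M ^\<^sub>m k) $$ (i, p) * M $$ (p, j))"
    unfolding sum_distrib_left by (intro sum.cong) (auto simp: Suc.IH)
  also have "(\<Sum>p<m. (M ^\<^sub>m k) $$ (i, p) * M $$ (p, j)) = (M ^\<^sub>m Suc k) $$ (i, j)"
    using M Mk assms Suc.prems by (auto simp: scalar_prod_def atLeast0LessThan intro!: sum.cong)
  finally show ?case .
qed

lemma mat_exp_carrier: "M \<in> carrier_mat m m \<Longrightarrow> mat_exp M \<in> carrier_mat m m"
  by (intro carrier_matI) (simp_all only: mat_exp_def dim_row_mat dim_col_mat carrier_matD)

text \<open>
  Each entry of \<open>exp(z M) v\<close> is an entire function whose \<open>k\<close>-th derivative at 0 is that entry of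
  \<open>M\<^sup>k v\<close>. The derivative, the initial value and the block
  structure of such functions are read off from this series.
\<close>

lemma mat_exp_mult_vec_sums:
  assumes M: "M \<in> carrier_mat m m" and v: "v \<in> carrier_vec m" and i: "i < m"
  shows "(\<lambda>k. (M ^\<^sub>m k *\<^sub>v v) $ i * z ^ k / fact k) sums ((mat_exp (z \<cdot>\<^sub>m M) *\<^sub>v v) $ i)"
proof -
  let ?B = "\<Sum>p<m. \<Sum>q<m. cmod (M $$ (p, q))"
  have B: "?B \<ge> 0" by (intro sum_nonneg) auto
  have entry: "(\<lambda>k. (M ^\<^sub>m k) $$ (i, j) * z ^ k / fact k) sums (mat_exp (z \<cdot>\<^sub>m M) $$ (i, j))"
    if j: "j < m" for j
  proof -
    have "summable (\<lambda>k. (M ^\<^sub>m k) $$ (i, j) * z ^ k / fact k)"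
    proof (rule summable_comparison_test')
      show "summable (\<lambda>k. (?B * cmod z) ^ k /\<^sub>R fact k)" by (rule summable_exp_generic)
      show "cmod ((M ^\<^sub>m k) $$ (i, j) * z ^ k / fact k) \<le> (?B * cmod z) ^ k /\<^sub>R fact k" for k
      proof -
        have "cmod ((M ^\<^sub>m k) $$ (i, j) * z ^ k / fact k) \<le> ?B ^ k * cmod z ^ k / fact k"
          unfolding norm_mult norm_divide norm_power norm_fact
          by (intro divide_right_mono mult_right_mono norm_pow_mat_entry_le[OF M i j]) auto
        then show ?thesis by (simp only: power_mult_distrib real_scaleR_def divide_inverse mult.commute)
      qed
    qed
    then show ?thesis
      using M i j by (simp add: mat_exp_def pow_smult_mat_index[OF M] summable_sums mult.commute)
  qed
  have "(\<lambda>k. \<Sum>j<m. (M ^\<^sub>m k) $$ (i, j) * z ^ k / fact k * v $ j) sums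
      (\<Sum>j<m. mat_exp (z \<cdot>\<^sub>m M) $$ (i, j) * v $ j)"
    by (intro sums_sum sums_mult2 entry) auto
  moreover have "(\<Sum>j<m. (M ^\<^sub>m k) $$ (i, j) * z ^ k / fact k * v $ j) =
      (M ^\<^sub>m k *\<^sub>v v) $ i * z ^ k / fact k" for k
    using M v i
    by (simp add: mult_mat_vec_index_sum[of _ m m] sum_distrib_left sum_distrib_right
        sum_divide_distrib mult_ac del: index_mult_mat_vec)
  moreover have "(\<Sum>j<m. mat_exp (z \<cdot>\<^sub>m M) $$ (i, j) * v $ j) = (mat_exp (z \<cdot>\<^sub>m M) *\<^sub>v v) $ i"
    using M v i mat_exp_carrier[of "z \<cdot>\<^sub>m M" m] by (simp add: mult_mat_vec_index_sum[of _ m m] del: index_mult_mat_vec)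
  ultimately show ?thesis by simp
qed

text \<open>
  Termwise differentiation shifts the coefficients \<open>M\<^sup>k v\<close> by one, which is multiplication by \<open>M\<close>.
\<close>

lemma mat_exp_mult_vec_has_vector_derivative:
  assumes M: "M \<in> carrier_mat m m" and v: "v \<in> carrier_vec m" and i: "i < m"
  shows "((\<lambda>s. (mat_exp (of_real s \<cdot>\<^sub>m M) *\<^sub>v v) $ i) has_vector_derivative
    (M *\<^sub>v (mat_exp (of_real s \<cdot>\<^sub>m M) *\<^sub>v v)) $ i) (at s within S)"
proof -
  define c where "c k = (M ^\<^sub>m k *\<^sub>v v) $ i / fact k" for k
  define y where "y z = mat_exp (z \<cdot>\<^sub>m M) *\<^sub>v v" for z
  have y: "y z \<in> carrier_vec m" for z
    unfolding y_def using M v by (intro mult_mat_vec_carrier[of _ m m] mat_exp_carrier) auto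
  have c: "(\<lambda>k. c k * z ^ k) sums (y z $ i)" for z
    unfolding c_def y_def using mat_exp_mult_vec_sums[OF assms, of z] by simp
  have "((\<lambda>z. \<Sum>k. c k * z ^ k) has_field_derivative (\<Sum>k. diffs c k * z ^ k)) (at z)" for z
    using c by (intro termdiffs_strong_converges_everywhere) (auto simp: sums_iff)
  then have "((\<lambda>z. y z $ i) has_field_derivative (\<Sum>k. diffs c k * z ^ k)) (at z)" for z
    using sums_unique[OF c] by simp
  moreover have "(\<Sum>k. diffs c k * z ^ k) = (M *\<^sub>v y z) $ i" for z
  proof -
    have "(\<lambda>k. \<Sum>j<m. M $$ (i, j) * ((M ^\<^sub>m k *\<^sub>v v) $ j * z ^ k / fact k)) sums
        (\<Sum>j<m. M $$ (i, j) * y z $ j)"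
      unfolding y_def by (intro sums_sum sums_mult mat_exp_mult_vec_sums[OF M v]) auto
    moreover have "(\<Sum>j<m. M $$ (i, j) * ((M ^\<^sub>m k *\<^sub>v v) $ j * z ^ k / fact k)) =
        diffs c k * z ^ k" for k
    proof -
      have x: "M ^\<^sub>m k *\<^sub>v v \<in> carrier_vec m"
        using M v by (intro mult_mat_vec_carrier[of _ m m]) auto
      have "diffs c k = (M *\<^sub>v (M ^\<^sub>m k *\<^sub>v v)) $ i / fact k"
        unfolding diffs_def c_def pow_mat_Suc_mult_vec[OF M v]
        by (simp del: of_nat_Suc)
      also have "\<dots> * z ^ k = (\<Sum>j<m. M $$ (i, j) * ((M ^\<^sub>m k *\<^sub>v v) $ j * z ^ k / fact k))"
        unfolding mult_mat_vec_index_sum[OF M x i]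
        by (simp add: sum_distrib_left sum_distrib_right sum_divide_distrib mult_ac)
      finally show ?thesis ..
    qed
    ultimately show ?thesis
      using M y i by (simp add: mult_mat_vec_index_sum[of _ m m] sums_iff del: index_mult_mat_vec)
  qed
  ultimately show ?thesis
    unfolding y_def by (intro has_vector_derivative_real_field) simp
qed

section \<open>The truncated recurrence matrices\<close>

definition bessel_mat :: "complex \<Rightarrow> nat \<Rightarrow> complex Matrix.mat" where
  "bessel_mat \<sigma> N = Matrix.mat N N (\<lambda>(i, j).
     if i = Suc j then 1 / 2
     else if j = Suc i then (if i = 0 then \<sigma> else \<sigma> / 2)
     else 0)"

lemma H_J_eq: "H_J = bessel_mat (-1)"
  by (intro ext eq_matI) (auto simp: H_J_def bessel_mat_def)

lemma H_I_eq: "H_I = bessel_mat 1"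
  by (simp add: fun_eq_iff H_I_def bessel_mat_def)

lemma bessel_mat_carrier [simp]: "bessel_mat \<sigma> N \<in> carrier_mat N N"
  by (simp add: bessel_mat_def)

lemma bessel_mat_mult_vec_0:
  assumes "x \<in> carrier_vec N" "0 < N"
  shows "(bessel_mat \<sigma> N *\<^sub>v x) $ 0 = (if 1 < N then \<sigma> * x $ 1 else 0)"
proof -
  have "(bessel_mat \<sigma> N *\<^sub>v x) $ 0 = (\<Sum>j<N. bessel_mat \<sigma> N $$ (0, j) * x $ j)"
    by (rule mult_mat_vec_index_sum[OF bessel_mat_carrier assms])
  also have "\<dots> = (\<Sum>j<N. if j = 1 then \<sigma> * x $ j else 0)"
    using assms by (intro sum.cong) (auto simp: bessel_mat_def)
  finally show ?thesis by simp
qed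

lemma bessel_mat_mult_vec_Suc:
  assumes "x \<in> carrier_vec N" "Suc i < N"
  shows "(bessel_mat \<sigma> N *\<^sub>v x) $ Suc i =
    (x $ i + (if Suc (Suc i) < N then \<sigma> * x $ Suc (Suc i) else 0)) / 2"
proof -
  have "(bessel_mat \<sigma> N *\<^sub>v x) $ Suc i = (\<Sum>j<N. bessel_mat \<sigma> N $$ (Suc i, j) * x $ j)"
    by (rule mult_mat_vec_index_sum[OF bessel_mat_carrier assms])
  also have "\<dots> = (\<Sum>j<N.
      (if j = i then x $ j / 2 else 0) + (if j = Suc (Suc i) then \<sigma> / 2 * x $ j else 0))"
    using assms by (intro sum.cong) (auto simp: bessel_mat_def)
  finally show ?thesis using assms by (simp add: sum.distrib add_divide_distrib)
qed

lemma norm_bessel_mat_pow_le_1: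
  assumes "cmod \<sigma> \<le> 1" "i < N"
  shows "cmod ((bessel_mat \<sigma> N ^\<^sub>m k *\<^sub>v unit_vec N 0) $ i) \<le> 1"
  using \<open>i < N\<close>
proof (induction k arbitrary: i)
  case 0
  then show ?case by (simp add: bessel_mat_def)
next
  case (Suc k)
  let ?x = "bessel_mat \<sigma> N ^\<^sub>m k *\<^sub>v unit_vec N 0"
  have x: "?x \<in> carrier_vec N" by (intro mult_mat_vec_carrier[of _ N N] pow_carrier_mat) auto
  have \<sigma>: "cmod (if j < N then \<sigma> * ?x $ j else 0) \<le> 1" for j
    using Suc.IH[of j] assms(1) by (auto simp: norm_mult intro: mult_le_one)
  show ?case
  proof (cases i)
    case 0
    then show ?thesis
      using Suc.prems \<sigma>[of 1] x by (simp add: pow_mat_Suc_mult_vec[of _ N] bessel_mat_mult_vec_0 del: pow_mat.simps)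
  next
    case (Suc i')
    then have i: "Suc i' < N" using Suc.prems by simp
    have "cmod (?x $ i' + (if Suc (Suc i') < N then \<sigma> * ?x $ Suc (Suc i') else 0)) \<le> 1 + 1"
      using i by (intro norm_triangle_mono \<sigma> Suc.IH) auto
    then show ?thesis
      using i x unfolding Suc
      by (subst pow_mat_Suc_mult_vec[of _ N]) (auto simp: bessel_mat_mult_vec_Suc norm_divide)
  qed
qed

text \<open>
  The truncation changes only the last row, where it drops a multiple of the entry with index \<open>N\<close>; by
  \<open>bessel_coeff_eq_0\<close> that entry is still 0 in the first \<open>N\<close> powers.
\<close>

lemma bessel_mat_pow_eq_bessel_coeff:
  assumes "k < N" "i < N"
  shows "(bessel_mat \<sigma> N ^\<^sub>m k *\<^sub>v unit_vec N 0) $ i = bessel_coeff \<sigma> k i"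
  using assms
proof (induction k arbitrary: i)
  case 0
  then show ?case by (simp add: bessel_mat_def)
next
  case (Suc k)
  let ?x = "bessel_mat \<sigma> N ^\<^sub>m k *\<^sub>v unit_vec N 0"
  have x: "?x \<in> carrier_vec N" by (intro mult_mat_vec_carrier[of _ N N] pow_carrier_mat) auto
  have IH: "?x $ j = bessel_coeff \<sigma> k j" if "j < N" for j using Suc that by simp
  show ?case
  proof (cases i)
    case 0
    then show ?thesis
      using Suc.prems x IH by (simp add: pow_mat_Suc_mult_vec[of _ N] bessel_mat_mult_vec_0 del: pow_mat.simps)
  next
    case (Suc i')
    then have i: "Suc i' < N" using Suc.prems by simp
    have "(if Suc (Suc i') < N then \<sigma> * ?x $ Suc (Suc i') else 0) = \<sigma> * bessel_coeff \<sigma> k (Suc (Suc i'))"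
      using IH Suc.prems i by (auto simp: bessel_coeff_eq_0)
    then show ?thesis
      using i x IH[of i'] unfolding Suc
      by (subst pow_mat_Suc_mult_vec[of _ N]) (auto simp: bessel_mat_mult_vec_Suc)
  qed
qed

section \<open>Expansions in Bessel functions\<close>

lemma coeff_mat_carrier: "coeff_mat n w N \<in> carrier_mat n N"
  by (intro carrier_matI) (simp_all add: coeff_mat_def)

lemma coeff_mat_mult_vec_index:
  assumes "\<And>l. w l \<in> carrier_vec n" "v \<in> carrier_vec N" "i < n"
  shows "(coeff_mat n w N *\<^sub>v v) $ i = (\<Sum>l<N. w l $ i * v $ l)"
  using assms coeff_mat_carrier
  by (subst mult_mat_vec_index_sum[of _ n N])
    (auto simp: coeff_mat_def mat_of_cols_index intro!: sum.cong)

text \<open>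
  The properties of the two families on which the convergence rests: the power series, and for each
  \<open>x \<ge> 0\<close> one point \<open>z\<close> at which all basis functions are bounded from below at once.
\<close>

definition bessel_like :: "complex \<Rightarrow> (nat \<Rightarrow> complex \<Rightarrow> complex) \<Rightarrow> bool" where
  "bessel_like \<sigma> \<phi> \<longleftrightarrow> cmod \<sigma> \<le> 1 \<and>
     (\<forall>l z. (\<lambda>k. bessel_coeff \<sigma> k l * z ^ k / fact k) sums \<phi> l z) \<and>
     (\<forall>x\<ge>0. \<exists>z. \<forall>l. (x / 2) ^ l / fact l \<le> cmod (\<phi> l z))"

lemma bessel_like_I: "bessel_like 1 bessel_I"
  unfolding bessel_like_def using bessel_I_sums norm_bessel_I_ge by simp metis

lemma bessel_like_J: "bessel_like (-1) bessel_J"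
proof -
  have "cmod (bessel_J l (\<i> * of_real x)) = cmod (bessel_I l (of_real x))" for l x
    by (simp add: bessel_I_def norm_mult norm_power)
  then have "\<exists>z. \<forall>l. (x / 2) ^ l / fact l \<le> cmod (bessel_J l z)" if "x \<ge> 0" for x
    using norm_bessel_I_ge[OF that] by metis
  then show ?thesis unfolding bessel_like_def using bessel_J_sums by auto
qed

text \<open>
  The expansion converges at the point where every \<open>\<bar>\<phi>\<^sub>l\<bar>\<close> is at least \<open>R\<^sup>l / l!\<close>, and there its terms
  are bounded. As the expansion converges everywhere, \<open>R\<close> is arbitrary.
\<close>

lemma expansion_coeff_decay:
  assumes \<phi>: "bessel_like \<sigma> \<phi>" and S: "\<And>z. (\<lambda>l. c l * \<phi> l z) sums S z" and "R > 0"
  shows "\<exists>C\<ge>0. \<forall>l. cmod (c l) \<le> C * fact l / R ^ l"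
proof -
  obtain z where z: "\<And>l. (2 * R / 2) ^ l / fact l \<le> cmod (\<phi> l z)"
    using \<phi> \<open>R > 0\<close> unfolding bessel_like_def
    by (metis less_imp_le mult_nonneg_nonneg zero_le_numeral)
  have "(\<lambda>l. c l * \<phi> l z) \<longlonglongrightarrow> 0"
    using S[of z] by (intro summable_LIMSEQ_zero) (simp add: sums_iff)
  then have "Bseq (\<lambda>l. c l * \<phi> l z)" by (intro convergent_imp_Bseq convergentI)
  then obtain C where C: "C > 0" "\<And>l. cmod (c l * \<phi> l z) \<le> C" unfolding Bseq_def by auto
  have "cmod (c l) \<le> C * fact l / R ^ l" for l
  proof -
    have "cmod (c l) * (R ^ l / fact l) \<le> cmod (c l * \<phi> l z)"
      unfolding norm_mult using z[of l] by (intro mult_left_mono) auto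
    also note C(2)
    finally show ?thesis using \<open>R > 0\<close> by (simp add: field_simps)
  qed
  with C(1) show ?thesis by (intro exI[of _ C]) auto
qed

lemma bessel_exp_carrier: "mat_exp (z \<cdot>\<^sub>m bessel_mat \<sigma> N) *\<^sub>v unit_vec N 0 \<in> carrier_vec N"
  by (intro mult_mat_vec_carrier[of _ N N] mat_exp_carrier) auto

lemma basis_err_carrier: "basis_err \<phi> (bessel_mat \<sigma>) N s \<in> carrier_vec N"
  unfolding basis_err_def using bessel_exp_carrier by (intro minus_carrier_vec) auto

lemma basis_err_index:
  assumes "l < N"
  shows "basis_err \<phi> (bessel_mat \<sigma>) N s $ l =
    \<phi> l (of_real s) - (mat_exp (of_real s \<cdot>\<^sub>m bessel_mat \<sigma> N) *\<^sub>v unit_vec N 0) $ l"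
proof -
  have "dim_vec (mat_exp (of_real s \<cdot>\<^sub>m bessel_mat \<sigma> N) *\<^sub>v unit_vec N 0) = N"
    using bessel_exp_carrier by (metis carrier_vecD)
  then show ?thesis unfolding basis_err_def using assms by (subst index_minus_vec) auto
qed

text \<open>
  The Taylor series of \<open>\<phi>\<^sub>l\<close> and of the entry \<open>l\<close> of \<open>exp(s H\<^sub>N) e\<^sub>1\<close> have the same
  derivatives of order below \<open>N\<close> at 0, and those of higher order differ by at most 2.
\<close>

lemma norm_basis_err_le:
  assumes \<phi>: "bessel_like \<sigma> \<phi>" and "s \<ge> 0" and l: "l < N"
  shows "cmod (basis_err \<phi> (bessel_mat \<sigma>) N s $ l) \<le> 2 * exp s * s ^ N / fact N"
proof (rule norm_exp_series_tail_le)
  let ?h = "\<lambda>k. (bessel_mat \<sigma> N ^\<^sub>m k *\<^sub>v unit_vec N 0) $ l"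
  let ?c = "\<lambda>k. bessel_coeff \<sigma> k l - ?h k"
  have \<sigma>: "cmod \<sigma> \<le> 1" using \<phi> unfolding bessel_like_def by simp
  show "?c k = 0" if "k < N" for k using bessel_mat_pow_eq_bessel_coeff[OF that l] by simp
  have "cmod (?c k) \<le> 1 + 1" for k
    using \<sigma> l by (intro norm_triangle_le_diff add_mono norm_bessel_coeff_le_1 norm_bessel_mat_pow_le_1)
  then show "cmod (?c k) \<le> 2" for k by simp
  have "(\<lambda>k. bessel_coeff \<sigma> k l * of_real s ^ k / fact k - ?h k * of_real s ^ k / fact k) sums
      (\<phi> l (of_real s) - (mat_exp (of_real s \<cdot>\<^sub>m bessel_mat \<sigma> N) *\<^sub>v unit_vec N 0) $ l)"
    using \<phi> l unfolding bessel_like_def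
    by (intro sums_diff mat_exp_mult_vec_sums[of _ N]) auto
  then show "(\<lambda>k. ?c k * of_real s ^ k / fact k) sums (basis_err \<phi> (bessel_mat \<sigma>) N s $ l)"
    by (simp add: basis_err_index[OF l] diff_divide_distrib left_diff_distrib)
qed fact

lemma norm_bessel_like_le:
  assumes \<phi>: "bessel_like \<sigma> \<phi>" and "s \<ge> 0"
  shows "cmod (\<phi> l (of_real s)) \<le> exp s * s ^ l / fact l"
  using assms norm_exp_series_tail_le[of l "\<lambda>k. bessel_coeff \<sigma> k l" 1 s "\<phi> l (of_real s)"]
  unfolding bessel_like_def by (auto simp: bessel_coeff_eq_0 norm_bessel_coeff_le_1)

text \<open>
  The decay rate \<open>R = 2 T\<close> of the coefficients turns the factors \<open>T\<^sup>N\<close> and \<open>T\<^sup>l\<close> in the bounds for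
  \<open>\<epsilon>\<^sub>N\<close> and \<open>\<phi>\<^sub>l\<close> into powers of \<open>1/2\<close>. One constant serves the whole interval \<open>[0, T]\<close>, since the
  bounds increase with \<open>s\<close>; the comparison of \<open>u\<close> with \<open>u\<^sub>N\<close> relies on this uniformity.
\<close>

lemma expansion_errors_le:
  assumes \<phi>: "bessel_like \<sigma> \<phi>" and S: "\<And>z. (\<lambda>l. c l * \<phi> l z) sums S z" and T: "T > 0"
  shows "\<exists>K\<ge>0. \<forall>N. \<forall>s\<in>{0..T}.
    cmod (\<Sum>l<N. c l * basis_err \<phi> (bessel_mat \<sigma>) N s $ l) \<le> K / 2 ^ N \<and>
    cmod (S (of_real s) - (\<Sum>l<N. c l * \<phi> l (of_real s))) \<le> K / 2 ^ N"
proof -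
  define R where "R = 2 * T"
  have R: "R > 0" using T unfolding R_def by simp
  obtain C where C: "C \<ge> 0" and decay: "\<And>l. cmod (c l) \<le> C * fact l / R ^ l"
    using expansion_coeff_decay[OF \<phi> S R] by auto
  have ratio: "T ^ l / R ^ l = 1 / 2 ^ l" for l
    using T by (simp add: R_def power_mult_distrib)
  define K where "K = max (2 * C * exp T * exp R) (2 * (C * exp T))"
  have "cmod (\<Sum>l<N. c l * basis_err \<phi> (bessel_mat \<sigma>) N s $ l) \<le> K / 2 ^ N" (is ?thesis1)
    and "cmod (S (of_real s) - (\<Sum>l<N. c l * \<phi> l (of_real s))) \<le> K / 2 ^ N" (is ?thesis2)
    if s: "s \<in> {0..T}" for s N
  proof -
    have "cmod (basis_err \<phi> (bessel_mat \<sigma>) N s $ l) \<le> (2 * exp T * T ^ N) / fact N" if "l < N" for l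
    proof -
      have "2 * exp s * s ^ N / fact N \<le> (2 * exp T * T ^ N) / fact N"
        using s by (intro divide_right_mono mult_mono power_mono) auto
      with norm_basis_err_le[OF \<phi> _ that] s show ?thesis by fastforce
    qed
    from norm_sum_fact_weights_le[OF decay R this _ C]
    have "cmod (\<Sum>l<N. c l * basis_err \<phi> (bessel_mat \<sigma>) N s $ l) \<le>
        C * (2 * exp T * T ^ N) * exp R / R ^ N" using T by simp
    also have "\<dots> = 2 * C * exp T * exp R * (T ^ N / R ^ N)" by simp
    also have "\<dots> \<le> K / 2 ^ N" unfolding ratio K_def by (simp add: divide_right_mono)
    finally show ?thesis1 .
    have "cmod (c l * \<phi> l (of_real s)) \<le> C * exp T / 2 ^ l" for l
    proof -
      have "cmod (\<phi> l (of_real s)) \<le> exp s * s ^ l / fact l"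
        using s by (intro norm_bessel_like_le[OF \<phi>]) auto
      also have "\<dots> \<le> exp T * T ^ l / fact l"
        using s by (intro divide_right_mono mult_mono power_mono) auto
      finally have "cmod (c l * \<phi> l (of_real s)) \<le> (C * fact l / R ^ l) * (exp T * T ^ l / fact l)"
        unfolding norm_mult using C R by (intro mult_mono decay) auto
      also have "\<dots> = C * exp T * (T ^ l / R ^ l)" by simp
      finally show ?thesis unfolding ratio by simp
    qed
    from norm_geometric_tail_le[OF S this]
    have "cmod (S (of_real s) - (\<Sum>l<N. c l * \<phi> l (of_real s))) \<le> 2 * (C * exp T) / 2 ^ N" .
    also have "\<dots> \<le> K / 2 ^ N" unfolding K_def by (intro divide_right_mono) auto
    finally show ?thesis2 .
  qed
  moreover have "K \<ge> 0" using C unfolding K_def by (simp add: le_max_iff_disj)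
  ultimately show ?thesis by blast
qed

section \<open>The augmented system\<close>

lemma append_vec_index:
  assumes "a \<in> carrier_vec n" "b \<in> carrier_vec N"
  shows "i < n \<Longrightarrow> (a @\<^sub>v b) $ i = a $ i" and "l < N \<Longrightarrow> (a @\<^sub>v b) $ (n + l) = b $ l"
  using assms by auto

lemma aug_mat_carrier:
  assumes "A \<in> carrier_mat n n"
  shows "aug_mat n A w (bessel_mat \<sigma>) N \<in> carrier_mat (n + N) (n + N)"
  unfolding aug_mat_def using assms by (intro four_block_carrier_mat) auto

lemma aug_mat_mult_append:
  assumes "A \<in> carrier_mat n n" "a \<in> carrier_vec n" "b \<in> carrier_vec N"
  shows "aug_mat n A w (bessel_mat \<sigma>) N *\<^sub>v (a @\<^sub>v b) =
    (A *\<^sub>v a + coeff_mat n w N *\<^sub>v b) @\<^sub>v (bessel_mat \<sigma> N *\<^sub>v b)"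
proof -
  have "0\<^sub>m N n *\<^sub>v a = 0\<^sub>v N"
    using assms by (intro eq_vecI) auto
  then have "0\<^sub>m N n *\<^sub>v a + bessel_mat \<sigma> N *\<^sub>v b = bessel_mat \<sigma> N *\<^sub>v b"
    using mult_mat_vec_carrier[OF bessel_mat_carrier[of \<sigma> N] assms(3)] by (metis left_zero_vec)
  then show ?thesis
    unfolding aug_mat_def
    using assms four_block_mat_mult_vec[OF assms(1) coeff_mat_carrier _ bessel_mat_carrier, of "0\<^sub>m N n"]
    by simp
qed

text \<open>
  The augmented matrix is block upper triangular, so the lower part evolves by \<open>H\<^sub>N\<close> alone.
\<close>

lemma aug_mat_pow_lower_block:
  assumes A: "A \<in> carrier_mat n n" and u0: "u0 \<in> carrier_vec n"
  shows "\<exists>a\<in>carrier_vec n. aug_mat n A w (bessel_mat \<sigma>) N ^\<^sub>m k *\<^sub>v (u0 @\<^sub>v unit_vec N 0) =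
    a @\<^sub>v (bessel_mat \<sigma> N ^\<^sub>m k *\<^sub>v unit_vec N 0)"
proof (induction k)
  case 0
  let ?M = "aug_mat n A w (bessel_mat \<sigma>) N"
  have "dim_row ?M = n + N" using aug_mat_carrier[OF A] by (metis carrier_matD(1))
  moreover have "dim_row (bessel_mat \<sigma> N) = N" by (simp add: bessel_mat_def)
  moreover have "u0 @\<^sub>v unit_vec N 0 \<in> carrier_vec (n + N)" using u0 by simp
  ultimately show ?case using u0 by (auto intro!: bexI[of _ u0])
next
  case (Suc k)
  let ?M = "aug_mat n A w (bessel_mat \<sigma>) N" and ?b = "bessel_mat \<sigma> N ^\<^sub>m k *\<^sub>v unit_vec N 0"
  obtain a where a: "a \<in> carrier_vec n" "?M ^\<^sub>m k *\<^sub>v (u0 @\<^sub>v unit_vec N 0) = a @\<^sub>v ?b"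
    using Suc by auto
  have b: "?b \<in> carrier_vec N" by (intro mult_mat_vec_carrier[of _ N N] pow_carrier_mat) auto
  have v: "u0 @\<^sub>v unit_vec N 0 \<in> carrier_vec (n + N)" using u0 by simp
  have "?M ^\<^sub>m Suc k *\<^sub>v (u0 @\<^sub>v unit_vec N 0) =
      (A *\<^sub>v a + coeff_mat n w N *\<^sub>v ?b) @\<^sub>v (bessel_mat \<sigma> N *\<^sub>v ?b)"
    unfolding pow_mat_Suc_mult_vec[OF aug_mat_carrier[OF A] v] a(2)
    by (rule aug_mat_mult_append[OF A a(1) b])
  moreover have "bessel_mat \<sigma> N *\<^sub>v ?b = bessel_mat \<sigma> N ^\<^sub>m Suc k *\<^sub>v unit_vec N 0"
    by (rule pow_mat_Suc_mult_vec[of _ N, symmetric]) auto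
  moreover have "A *\<^sub>v a + coeff_mat n w N *\<^sub>v ?b \<in> carrier_vec n"
    using A a b coeff_mat_carrier by (intro add_carrier_vec mult_mat_vec_carrier[of _ n])
  ultimately show ?case by metis
qed

text \<open>
  The upper part is \<open>u\<^sub>N\<close> by definition; the lower part is recognised entry by entry from the power
  series, whose coefficients are the lower parts of the powers.
\<close>

lemma aug_mat_exp_split:
  fixes w :: "nat \<Rightarrow> complex Matrix.vec" and \<sigma> :: complex and N :: nat
  assumes A: "A \<in> carrier_mat n n" and u0: "u0 \<in> carrier_vec n"
  defines "y \<equiv> \<lambda>t. mat_exp (of_real t \<cdot>\<^sub>m aug_mat n A w (bessel_mat \<sigma>) N) *\<^sub>v (u0 @\<^sub>v unit_vec N 0)"
  shows "y t = approx_sol n A u0 w (bessel_mat \<sigma>) N t @\<^sub>v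
      (mat_exp (of_real t \<cdot>\<^sub>m bessel_mat \<sigma> N) *\<^sub>v unit_vec N 0)"
    and "approx_sol n A u0 w (bessel_mat \<sigma>) N t \<in> carrier_vec n"
proof -
  let ?M = "aug_mat n A w (bessel_mat \<sigma>) N" and ?v = "u0 @\<^sub>v unit_vec N 0"
  let ?z = "mat_exp (of_real t \<cdot>\<^sub>m bessel_mat \<sigma> N) *\<^sub>v unit_vec N 0"
  have M: "?M \<in> carrier_mat (n + N) (n + N)" by (rule aug_mat_carrier[OF A])
  have v: "?v \<in> carrier_vec (n + N)" using u0 by simp
  have y: "y t \<in> carrier_vec (n + N)"
    unfolding y_def using M v by (intro mult_mat_vec_carrier[of _ "n + N" "n + N"] mat_exp_carrier) auto
  have z: "?z \<in> carrier_vec N" by (rule bessel_exp_carrier)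
  have split: "vec_first (y t) n @\<^sub>v vec_last (y t) N = y t"
    using y by (rule vec_first_last_append)
  have "vec_last (y t) N = ?z"
  proof (rule eq_vecI)
    fix l assume "l < dim_vec ?z"
    then have l: "l < N" using z by (metis carrier_vecD)
    have "(\<lambda>k. (?M ^\<^sub>m k *\<^sub>v ?v) $ (n + l) * of_real t ^ k / fact k) sums (y t $ (n + l))"
      unfolding y_def using l by (intro mat_exp_mult_vec_sums[OF M v]) simp
    moreover have "(?M ^\<^sub>m k *\<^sub>v ?v) $ (n + l) = (bessel_mat \<sigma> N ^\<^sub>m k *\<^sub>v unit_vec N 0) $ l" for k
    proof -
      have "bessel_mat \<sigma> N ^\<^sub>m k *\<^sub>v unit_vec N 0 \<in> carrier_vec N"
        by (intro mult_mat_vec_carrier[of _ N N] pow_carrier_mat) auto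
      then show ?thesis
        using aug_mat_pow_lower_block[OF A u0, of w \<sigma> N k] append_vec_index(2)[OF _ _ l] by metis
    qed
    moreover have "(\<lambda>k. (bessel_mat \<sigma> N ^\<^sub>m k *\<^sub>v unit_vec N 0) $ l * of_real t ^ k / fact k) sums (?z $ l)"
      using l by (intro mat_exp_mult_vec_sums[of _ N]) auto
    ultimately have "y t $ (n + l) = ?z $ l" by (simp add: sums_unique2 del: index_mult_mat_vec)
    then show "vec_last (y t) N $ l = ?z $ l"
      using y l by (simp add: vec_last_def del: index_mult_mat_vec)
  qed (use carrier_vecD[OF z] in \<open>simp add: vec_last_def\<close>)
  moreover have approx: "approx_sol n A u0 w (bessel_mat \<sigma>) N t = vec_first (y t) n"
  proof -
    have "approx_sol n A u0 w (bessel_mat \<sigma>) N t =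
        four_block_mat (1\<^sub>m n) (0\<^sub>m n N) (0\<^sub>m 0 n) (0\<^sub>m 0 N) *\<^sub>v (vec_first (y t) n @\<^sub>v vec_last (y t) N)"
      unfolding approx_sol_def split unfolding y_def ..
    also have "\<dots> = (1\<^sub>m n *\<^sub>v vec_first (y t) n + 0\<^sub>m n N *\<^sub>v vec_last (y t) N) @\<^sub>v
        (0\<^sub>m 0 n *\<^sub>v vec_first (y t) n + 0\<^sub>m 0 N *\<^sub>v vec_last (y t) N)"
      by (intro four_block_mat_mult_vec) auto
    also have "\<dots> = vec_first (y t) n"
      by (rule eq_vecI) (auto simp: vec_first_def scalar_prod_def)
    finally show ?thesis .
  qed
  ultimately show "y t = approx_sol n A u0 w (bessel_mat \<sigma>) N t @\<^sub>v ?z" using split by simp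
  show "approx_sol n A u0 w (bessel_mat \<sigma>) N t \<in> carrier_vec n" unfolding approx by simp
qed

text \<open>
  So \<open>u\<^sub>N\<close> solves the given equation with \<open>g\<close> replaced by \<open>W\<^sub>N exp(s H\<^sub>N) e\<^sub>1\<close>.
\<close>

lemma approx_sol_has_vector_derivative:
  assumes A: "A \<in> carrier_mat n n" and u0: "u0 \<in> carrier_vec n" and i: "i < n"
  shows "((\<lambda>s. approx_sol n A u0 w (bessel_mat \<sigma>) N s $ i) has_vector_derivative
    (A *\<^sub>v approx_sol n A u0 w (bessel_mat \<sigma>) N s) $ i +
    (coeff_mat n w N *\<^sub>v (mat_exp (of_real s \<cdot>\<^sub>m bessel_mat \<sigma> N) *\<^sub>v unit_vec N 0)) $ i) (at s within X)"
proof -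
  let ?M = "aug_mat n A w (bessel_mat \<sigma>) N" and ?v = "u0 @\<^sub>v unit_vec N 0"
  let ?a = "approx_sol n A u0 w (bessel_mat \<sigma>) N"
  let ?z = "\<lambda>t. mat_exp (of_real t \<cdot>\<^sub>m bessel_mat \<sigma> N) *\<^sub>v unit_vec N 0"
  note y = aug_mat_exp_split[OF A u0, where w = w and \<sigma> = \<sigma> and N = N]
  have idx: "(mat_exp (of_real t \<cdot>\<^sub>m ?M) *\<^sub>v ?v) $ i = ?a t $ i" for t
    unfolding y(1) by (rule append_vec_index(1)[OF y(2) bessel_exp_carrier i])
  have Wz: "coeff_mat n w N *\<^sub>v ?z s \<in> carrier_vec n"
    by (intro mult_mat_vec_carrier[of _ n N] coeff_mat_carrier bessel_exp_carrier)
  have Aa: "A *\<^sub>v ?a s \<in> carrier_vec n" by (intro mult_mat_vec_carrier[of _ n n] A y(2))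
  have "(?M *\<^sub>v (mat_exp (of_real s \<cdot>\<^sub>m ?M) *\<^sub>v ?v)) $ i = (A *\<^sub>v ?a s) $ i + (coeff_mat n w N *\<^sub>v ?z s) $ i"
    unfolding y(1) aug_mat_mult_append[OF A y(2) bessel_exp_carrier]
    using append_vec_index(1)[OF add_carrier_vec[OF Aa Wz] mult_mat_vec_carrier[OF bessel_mat_carrier bessel_exp_carrier] i]
      index_add_vec(1)[of i "coeff_mat n w N *\<^sub>v ?z s" "A *\<^sub>v ?a s"] i carrier_vecD[OF Wz]
    by simp
  moreover have "((\<lambda>s. (mat_exp (of_real s \<cdot>\<^sub>m ?M) *\<^sub>v ?v) $ i) has_vector_derivative
      (?M *\<^sub>v (mat_exp (of_real s \<cdot>\<^sub>m ?M) *\<^sub>v ?v)) $ i) (at s within X)"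
    using i u0 by (intro mat_exp_mult_vec_has_vector_derivative[OF aug_mat_carrier[OF A]]) auto
  ultimately show ?thesis unfolding idx by simp
qed

lemma approx_sol_0:
  assumes A: "A \<in> carrier_mat n n" and u0: "u0 \<in> carrier_vec n" and i: "i < n"
  shows "approx_sol n A u0 w (bessel_mat \<sigma>) N 0 $ i = u0 $ i"
proof -
  let ?M = "aug_mat n A w (bessel_mat \<sigma>) N" and ?v = "u0 @\<^sub>v unit_vec N 0"
  note y = aug_mat_exp_split[OF A u0, where w = w and \<sigma> = \<sigma> and N = N]
  have M: "?M \<in> carrier_mat (n + N) (n + N)" by (rule aug_mat_carrier[OF A])
  have v: "?v \<in> carrier_vec (n + N)" using u0 by simp
  have "(\<lambda>k. (?M ^\<^sub>m k *\<^sub>v ?v) $ i * 0 ^ k / fact k) sums ((mat_exp (of_real 0 \<cdot>\<^sub>m ?M) *\<^sub>v ?v) $ i)"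
    using mat_exp_mult_vec_sums[OF M v, of i 0] i by simp
  moreover have "(\<lambda>k. (?M ^\<^sub>m k *\<^sub>v ?v) $ i / fact k * 0 ^ k) sums ((?M ^\<^sub>m 0 *\<^sub>v ?v) $ i / fact 0)"
    by (rule powser_sums_zero)
  ultimately have "(mat_exp (of_real 0 \<cdot>\<^sub>m ?M) *\<^sub>v ?v) $ i = (?M ^\<^sub>m 0 *\<^sub>v ?v) $ i / fact 0"
    by (simp add: sums_unique2 del: index_mult_mat_vec pow_mat.simps)
  also have "?M ^\<^sub>m 0 *\<^sub>v ?v = ?v"
    using v carrier_matD(1)[OF M] by simp
  finally show ?thesis
    unfolding y(1) append_vec_index(1)[OF y(2) bessel_exp_carrier i]
      append_vec_index(1)[OF u0 unit_vec_carrier i] by simp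
qed

section \<open>Perturbation of a linear system\<close>

text \<open>
  The energy \<open>D = \<Sum>\<bar>d\<^sub>i\<bar>\<^sup>2\<close> satisfies \<open>D' \<le> K D + n \<rho>\<^sup>2\<close> with \<open>K = 2 \<Sum>\<bar>a\<^sub>i\<^sub>j\<bar> + 1\<close>, by Cauchy-Schwarz and
  \<open>2 x y \<le> x\<^sup>2 + y\<^sup>2\<close>. Hence \<open>e\<^bsup>-K s\<^esup> D(s) - n \<rho>\<^sup>2 s\<close> does not increase from its value 0 at 0. The
  factor in front of \<open>\<rho>\<^sup>2\<close> must not depend on \<open>d\<close> or \<open>r\<close>, which vary with the truncation index in the
  application.
\<close>

lemma linear_system_perturbation_bound:
  fixes d r :: "nat \<Rightarrow> real \<Rightarrow> complex" and a :: "nat \<Rightarrow> nat \<Rightarrow> complex"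
  assumes T: "T \<ge> 0"
    and cont: "\<And>i. i < n \<Longrightarrow> continuous_on {0..T} (d i)"
    and deriv: "\<And>i s. i < n \<Longrightarrow> 0 < s \<Longrightarrow> s < T \<Longrightarrow>
      (d i has_vector_derivative (\<Sum>j<n. a i j * d j s) + r i s) (at s)"
    and init: "\<And>i. i < n \<Longrightarrow> d i 0 = 0"
    and r: "\<And>i s. i < n \<Longrightarrow> 0 < s \<Longrightarrow> s < T \<Longrightarrow> cmod (r i s) \<le> \<rho>"
  shows "(\<Sum>i<n. (cmod (d i T))\<^sup>2) \<le>
    exp ((2 * (\<Sum>i<n. \<Sum>j<n. cmod (a i j)) + 1) * T) * (real n * T) * \<rho>\<^sup>2"
proof -
  define L where "L = (\<Sum>i<n. \<Sum>j<n. cmod (a i j))"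
  define K where "K = 2 * L + 1"
  define D where "D s = (\<Sum>i<n. inner (d i s) (d i s))" for s
  define F where "F i s = (\<Sum>j<n. a i j * d j s) + r i s" for i s
  define E where "E s = exp (- K * s) * D s - real n * \<rho>\<^sup>2 * s" for s
  have D_norm: "D s = (\<Sum>i<n. (cmod (d i s))\<^sup>2)" for s
    unfolding D_def by (simp add: power2_norm_eq_inner)
  have le_D: "(cmod (d i s))\<^sup>2 \<le> D s" if "i < n" for i s
    unfolding D_norm using that by (intro member_le_sum) auto
  have step: "2 * inner (d i s) (F i s) \<le>
      (\<Sum>j<n. cmod (a i j)) * (2 * D s) + (cmod (d i s))\<^sup>2 + \<rho>\<^sup>2"
    if i: "i < n" and s: "0 < s" "s < T" for i s
  proof -
    let ?x = "cmod (d i s)"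
    have "2 * inner (d i s) (F i s) \<le> 2 * (?x * cmod (F i s))"
      using norm_cauchy_schwarz[of "d i s" "F i s"] by simp
    also have "\<dots> \<le> 2 * (?x * ((\<Sum>j<n. cmod (a i j) * cmod (d j s)) + \<rho>))"
      unfolding F_def
      by (intro mult_left_mono norm_triangle_mono r i s sum_norm_le) (auto simp: norm_mult)
    also have "\<dots> = (\<Sum>j<n. cmod (a i j) * (2 * ?x * cmod (d j s))) + 2 * ?x * \<rho>"
      by (simp add: sum_distrib_left sum_distrib_right algebra_simps)
    also have "\<dots> \<le> (\<Sum>j<n. cmod (a i j) * (2 * D s)) + (?x\<^sup>2 + \<rho>\<^sup>2)"
    proof (intro add_mono sum_mono mult_left_mono)
      fix j assume j: "j \<in> {..<n}"
      have "2 * ?x * cmod (d j s) \<le> ?x\<^sup>2 + (cmod (d j s))\<^sup>2" by (rule sum_squares_bound)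
      also have "\<dots> \<le> D s + D s" using i j by (intro add_mono le_D) auto
      finally show "2 * ?x * cmod (d j s) \<le> 2 * D s" by simp
    qed (auto simp: sum_squares_bound)
    finally show ?thesis by (simp add: sum_distrib_right add_ac)
  qed
  have "E T \<le> E 0"
  proof (rule DERIV_nonpos_imp_decreasing_open[OF T])
    fix s assume s: "0 < s" "s < T"
    define D' where "D' = (\<Sum>i<n. 2 * inner (d i s) (F i s))"
    have "((\<lambda>s. inner (d i s) (d i s)) has_real_derivative 2 * inner (d i s) (F i s)) (at s)"
      if "i < n" for i
      using deriv[OF that s] unfolding F_def[symmetric] has_real_derivative_iff_has_vector_derivative
        has_vector_derivative_def
      by (auto intro!: derivative_eq_intros simp: inner_commute fun_eq_iff)
    then have "(D has_real_derivative D') (at s)"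
      unfolding D_def D'_def by (intro DERIV_sum) auto
    then have "(E has_real_derivative exp (- K * s) * (D' - K * D s) - real n * \<rho>\<^sup>2) (at s)"
      unfolding E_def by (auto intro!: derivative_eq_intros simp: algebra_simps)
    moreover have "exp (- K * s) * (D' - K * D s) - real n * \<rho>\<^sup>2 \<le> 0"
    proof -
      have "D' \<le> (\<Sum>i<n. (\<Sum>j<n. cmod (a i j)) * (2 * D s) + (cmod (d i s))\<^sup>2 + \<rho>\<^sup>2)"
        unfolding D'_def using step s by (intro sum_mono) auto
      also have "\<dots> = L * (2 * D s) + (\<Sum>i<n. (cmod (d i s))\<^sup>2) + real n * \<rho>\<^sup>2"
        unfolding L_def by (simp add: sum.distrib sum_distrib_right)
      also have "\<dots> = K * D s + real n * \<rho>\<^sup>2"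
        unfolding K_def D_norm[symmetric] by (simp add: algebra_simps)
      finally have "exp (- K * s) * (D' - K * D s) \<le> exp (- K * s) * (real n * \<rho>\<^sup>2)"
        by (intro mult_left_mono) auto
      also have "\<dots> \<le> 1 * (real n * \<rho>\<^sup>2)"
      proof (intro mult_right_mono)
        have "L \<ge> 0" unfolding L_def by (intro sum_nonneg) auto
        then have "K * s \<ge> 0" using s unfolding K_def by simp
        then show "exp (- K * s) \<le> 1" by simp
      qed auto
      finally show ?thesis by simp
    qed
    ultimately show "\<exists>y. (E has_real_derivative y) (at s) \<and> y \<le> 0" by blast
  next
    show "continuous_on {0..T} E"
      unfolding E_def D_def by (intro continuous_intros cont) auto
  qed
  also have "E 0 = 0" unfolding E_def D_def by (simp add: init)
  finally have "exp (- K * T) * D T \<le> real n * T * \<rho>\<^sup>2" unfolding E_def by (simp add: mult_ac)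
  then have "exp (K * T) * (exp (- K * T) * D T) \<le> exp (K * T) * (real n * T * \<rho>\<^sup>2)"
    by (intro mult_left_mono) auto
  moreover have "exp (K * T) * (exp (- K * T) * D T) = D T"
    unfolding mult.assoc[symmetric] exp_add[symmetric] by simp
  ultimately show ?thesis unfolding D_norm K_def L_def by (simp only: mult.assoc)
qed

section \<open>Convergence of the truncated expansion\<close>

lemma vec_norm_le:
  assumes "\<And>i. i < dim_vec v \<Longrightarrow> cmod (v $ i) \<le> b" "b \<ge> 0"
  shows "vec_norm v \<le> sqrt (real (dim_vec v)) * b"
proof -
  have "(\<Sum>i<dim_vec v. (cmod (v $ i))\<^sup>2) \<le> (\<Sum>i<dim_vec v. b\<^sup>2)"
    using assms by (intro sum_mono power_mono) auto
  then have "vec_norm v \<le> sqrt (real (dim_vec v) * b\<^sup>2)"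
    unfolding vec_norm_def by (intro real_sqrt_le_mono) simp
  then show ?thesis using assms(2) by (simp add: real_sqrt_mult)
qed

lemma vec_norm_nonneg: "vec_norm v \<ge> 0"
  unfolding vec_norm_def by (intro real_sqrt_ge_zero sum_nonneg) auto

theorem theorem11:
  fixes n :: nat
    and A :: "complex Matrix.mat"
    and u0 :: "complex Matrix.vec"
    and g :: "complex \<Rightarrow> complex Matrix.vec"
    and u :: "real \<Rightarrow> complex Matrix.vec"
    and w :: "nat \<Rightarrow> complex Matrix.vec"
    and \<phi> :: "nat \<Rightarrow> complex \<Rightarrow> complex"
    and H :: "nat \<Rightarrow> complex Matrix.mat"
  assumes A: "A \<in> carrier_mat n n"
    and u0: "u0 \<in> carrier_vec n"
    and g_dim: "\<And>s. g s \<in> carrier_vec n"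
    and g_entire: "\<And>i. i < n \<Longrightarrow> (\<lambda>s. g s $ i) holomorphic_on UNIV"
    and u_dim: "\<And>t. t \<ge> 0 \<Longrightarrow> u t \<in> carrier_vec n"
    and u_ode: "\<And>t i. t \<ge> 0 \<Longrightarrow> i < n \<Longrightarrow>
      ((\<lambda>s. u s $ i) has_vector_derivative (A *\<^sub>v u t + g (of_real t)) $ i) (at t within {0..})"
    and u_init: "u 0 = u0"
    and basis: "(\<phi> = bessel_J \<and> H = H_J) \<or> (\<phi> = bessel_I \<and> H = H_I)"
    and w_dim: "\<And>l. w l \<in> carrier_vec n"
    and g_expansion: "\<And>s i. i < n \<Longrightarrow> (\<lambda>l. w l $ i * \<phi> l s) sums (g s $ i)"
  shows "(\<forall>t>0. (\<lambda>N. vec_norm (coeff_mat n w N *\<^sub>v basis_err \<phi> H N t)) \<longlonglongrightarrow> 0) \<and>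
         (\<forall>t>0. (\<lambda>N. vec_norm (u t - approx_sol n A u0 w H N t)) \<longlonglongrightarrow> 0)"
proof -
  obtain \<sigma> where \<phi>: "bessel_like \<sigma> \<phi>" and H: "H = bessel_mat \<sigma>"
    using basis bessel_like_I bessel_like_J by (auto simp: H_I_eq H_J_eq)
  let ?\<epsilon> = "basis_err \<phi> (bessel_mat \<sigma>)" and ?a = "approx_sol n A u0 w (bessel_mat \<sigma>)"
  let ?z = "\<lambda>N s. mat_exp (of_real s \<cdot>\<^sub>m bessel_mat \<sigma> N) *\<^sub>v unit_vec N 0"
  have main: "(\<lambda>N. vec_norm (coeff_mat n w N *\<^sub>v ?\<epsilon> N t)) \<longlonglongrightarrow> 0 \<and> (\<lambda>N. vec_norm (u t - ?a N t)) \<longlonglongrightarrow> 0"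
    if t: "t > 0" for t
  proof -
    define errors_le where "errors_le i K \<longleftrightarrow> (\<forall>N. \<forall>s\<in>{0..t}.
        cmod (\<Sum>l<N. w l $ i * ?\<epsilon> N s $ l) \<le> K / 2 ^ N \<and>
        cmod (g (of_real s) $ i - (\<Sum>l<N. w l $ i * \<phi> l (of_real s))) \<le> K / 2 ^ N)"
      for i and K :: real
    have "\<exists>K. K \<ge> 0 \<and> errors_le i K" if "i < n" for i
      using expansion_errors_le[OF \<phi> g_expansion[OF that] t] unfolding errors_le_def by blast
    then have "\<forall>i. \<exists>K. K \<ge> 0 \<and> (i < n \<longrightarrow> errors_le i K)" by (metis order_refl)
    then obtain k where k: "\<And>i. k i \<ge> 0" and k_errors: "\<And>i. i < n \<Longrightarrow> errors_le i (k i)"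
      by metis
    have err: "cmod (\<Sum>l<N. w l $ i * ?\<epsilon> N s $ l) \<le> k i / 2 ^ N \<and>
        cmod (g (of_real s) $ i - (\<Sum>l<N. w l $ i * \<phi> l (of_real s))) \<le> k i / 2 ^ N"
      if "i < n" "s \<in> {0..t}" for i N s
      using k_errors[OF that(1)] that(2) unfolding errors_le_def by blast
    \<comment> \<open>The constants of the components are added up to get one bound for all of them.\<close>
    define K where "K = (\<Sum>i<n. k i)"
    have K: "K \<ge> 0" unfolding K_def using k by (intro sum_nonneg)
    have kK: "k i / 2 ^ N \<le> K / 2 ^ N" if "i < n" for i N
      unfolding K_def using k that by (intro divide_right_mono member_le_sum) auto
    have W\<epsilon>: "(coeff_mat n w N *\<^sub>v ?\<epsilon> N s) $ i = (\<Sum>l<N. w l $ i * ?\<epsilon> N s $ l)" if "i < n" for i N s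
      by (rule coeff_mat_mult_vec_index[OF w_dim basis_err_carrier that])
    have Wz: "(coeff_mat n w N *\<^sub>v ?z N s) $ i = (\<Sum>l<N. w l $ i * ?z N s $ l)" if "i < n" for i N s
      by (rule coeff_mat_mult_vec_index[OF w_dim bessel_exp_carrier that])
    have residual: "cmod (g (of_real s) $ i - (coeff_mat n w N *\<^sub>v ?z N s) $ i) \<le> 2 * K / 2 ^ N"
      if "i < n" "s \<in> {0..t}" for i s N
    proof -
      \<comment> \<open>The residual is the tail of the expansion of \<open>g\<close> plus \<open>W\<^sub>N \<epsilon>\<^sub>N(s)\<close>.\<close>
      have "(\<Sum>l<N. w l $ i * ?\<epsilon> N s $ l) = (\<Sum>l<N. w l $ i * \<phi> l (of_real s)) - (\<Sum>l<N. w l $ i * ?z N s $ l)"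
        unfolding sum_subtractf[symmetric]
        by (intro sum.cong) (auto simp: basis_err_index right_diff_distrib simp del: index_mult_mat_vec)
      then have "g (of_real s) $ i - (coeff_mat n w N *\<^sub>v ?z N s) $ i =
          (g (of_real s) $ i - (\<Sum>l<N. w l $ i * \<phi> l (of_real s))) + (\<Sum>l<N. w l $ i * ?\<epsilon> N s $ l)"
        unfolding Wz[OF that(1)] by simp
      also have "cmod \<dots> \<le> K / 2 ^ N + K / 2 ^ N"
        using err[OF that] kK[OF that(1)] by (intro norm_triangle_mono) (meson order_trans)+
      finally show ?thesis by simp
    qed
    have geometric: "(\<lambda>N. c / 2 ^ N) \<longlonglongrightarrow> 0" for c :: real
      using tendsto_mult[OF tendsto_const[of c] LIMSEQ_realpow_zero[of "1/2"]] by (simp add: power_divide)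
    have "vec_norm (coeff_mat n w N *\<^sub>v ?\<epsilon> N t) \<le> (sqrt (real n) * K) / 2 ^ N" for N
    proof -
      have dim: "dim_vec (coeff_mat n w N *\<^sub>v ?\<epsilon> N t) = n"
        using coeff_mat_carrier by (metis carrier_matD(1) dim_mult_mat_vec)
      have "cmod ((coeff_mat n w N *\<^sub>v ?\<epsilon> N t) $ i) \<le> K / 2 ^ N" if "i < n" for i
        using err[OF that, of t N] kK[OF that, of N] t unfolding W\<epsilon>[OF that] by auto
      then show ?thesis
        using vec_norm_le[of "coeff_mat n w N *\<^sub>v ?\<epsilon> N t" "K / 2 ^ N"] K unfolding dim by simp
    qed
    then have "(\<lambda>N. vec_norm (coeff_mat n w N *\<^sub>v ?\<epsilon> N t)) \<longlonglongrightarrow> 0"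
      by (intro tendsto_sandwich[OF _ _ tendsto_const geometric[of "sqrt (real n) * K"]])
        (auto simp: vec_norm_nonneg)
    moreover have "\<exists>C. \<forall>N. vec_norm (u t - ?a N t) \<le> C / 2 ^ N"
    proof -
      define C where "C = exp ((2 * (\<Sum>i<n. \<Sum>j<n. cmod (A $$ (i, j))) + 1) * t) * (real n * t)"
      have C: "C \<ge> 0" unfolding C_def using t by simp
      have "vec_norm (u t - ?a N t) \<le> sqrt C * (2 * K) / 2 ^ N" for N
      proof -
        note a_dim = aug_mat_exp_split(2)[OF A u0, where w = w and \<sigma> = \<sigma> and N = N]
        have a_mult: "(A *\<^sub>v x) $ i = (\<Sum>j<n. A $$ (i, j) * x $ j)" if "i < n" "x \<in> carrier_vec n" for i x
          by (rule mult_mat_vec_index_sum[OF A that(2,1)])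
        define d where "d i s = u s $ i - ?a N s $ i" for i s
        define r where "r i s = g (of_real s) $ i - (coeff_mat n w N *\<^sub>v ?z N s) $ i" for i s
        have d_deriv: "(d i has_vector_derivative (\<Sum>j<n. A $$ (i, j) * d j s) + r i s) (at s within {0..})"
          if i: "i < n" and s: "s \<ge> 0" for i s
        proof -
          have Au: "A *\<^sub>v u s \<in> carrier_vec n" by (intro mult_mat_vec_carrier[of _ n n] A u_dim s)
          have "(A *\<^sub>v u s + g (of_real s)) $ i - ((A *\<^sub>v ?a N s) $ i + (coeff_mat n w N *\<^sub>v ?z N s) $ i) =
              (\<Sum>j<n. A $$ (i, j) * d j s) + r i s"
            using g_dim[of "of_real s"] i unfolding d_def r_def right_diff_distrib sum_subtractf
            by (simp add: a_mult[OF i u_dim[OF s]] a_mult[OF i a_dim] del: index_mult_mat_vec)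
          with has_vector_derivative_diff[OF u_ode[OF s i]
              approx_sol_has_vector_derivative[OF A u0 i, of w \<sigma> N s "{0..}"]]
          show ?thesis unfolding d_def by simp
        qed
        have "(\<Sum>i<n. (cmod (d i t))\<^sup>2) \<le> C * (2 * K / 2 ^ N)\<^sup>2"
          unfolding C_def
        proof (rule linear_system_perturbation_bound[where r = r])
          show "continuous_on {0..t} (d i)" if "i < n" for i
          proof -
            have "continuous_on {0..} (d i)"
              by (rule continuous_on_vector_derivative[OF d_deriv[OF that]]) auto
            then show ?thesis by (rule continuous_on_subset) auto
          qed
          show "(d i has_vector_derivative (\<Sum>j<n. A $$ (i, j) * d j s) + r i s) (at s)"
            if "i < n" "0 < s" for i s
            using d_deriv[OF that(1), of s] that(2) by (simp add: at_within_interior[of s "{0..}"])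
          show "d i 0 = 0" if "i < n" for i
            unfolding d_def u_init approx_sol_0[OF A u0 that] by simp
          show "cmod (r i s) \<le> 2 * K / 2 ^ N" if "i < n" "0 < s" "s < t" for i s
            unfolding r_def using that by (intro residual) auto
        qed (use t in simp)
        moreover have "vec_norm (u t - ?a N t) = sqrt (\<Sum>i<n. (cmod (d i t))\<^sup>2)"
          unfolding vec_norm_def d_def using a_dim[of t] u_dim[of t] t by simp
        ultimately have "vec_norm (u t - ?a N t) \<le> sqrt (C * (2 * K / 2 ^ N)\<^sup>2)"
          by (simp only: real_sqrt_le_mono)
        also have "\<dots> = sqrt C * (2 * K) / 2 ^ N" using K by (simp add: real_sqrt_mult real_sqrt_divide)
        finally show ?thesis .
      qed
      then show ?thesis by blast
    qed
    then have "(\<lambda>N. vec_norm (u t - ?a N t)) \<longlonglongrightarrow> 0"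
      by (metis (no_types, lifting) tendsto_sandwich[OF _ _ tendsto_const geometric] vec_norm_nonneg
          always_eventually)
    ultimately show ?thesis ..
  qed
  then show ?thesis unfolding H by blast
qed

end
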